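(* Let $d\ge 1$, $s\in(0,1)$, let $N, N_v$ be positive integers, and let $A_{\text{FD}}$ be the uniform-grid finite difference matrix of size $(2N+1)^d\times(2N+1)^d$. Let $I_h^{\text{FD}}$ be a real matrix of size $(2N+1)^d\times N_v$ (a transfer matrix from the mesh $\mathcal{T}_h$ with $N_v$ vertices to the uniform grid $\mathcal{T}_{\text{FD}}$), let $D_h$ be the $N_v\times N_v$ diagonal matrix whose diagonal entries are the column sums of $I_h^{\text{FD}}$, and let $$A_h = D_h^{-1}(I_h^{\text{FD}})^T A_{\text{FD}}\, I_h^{\text{FD}} .$$ If $I_h^{\text{FD}}$ has full column rank and positive column sums, then $A_h$ is similar to a symmetric and positive definite matrix; more precisely, $$A_h = D_h^{-\frac12}\cdot \big(I_h^{\text{FD}} D_h^{-\frac12}\big)^T A_{\text{FD}} \big(I_h^{\text{FD}} D_h^{-\frac12}\big)\cdot D_h^{\frac12},$$ where $\big(I_h^{\text{FD}} D_h^{-\frac12}\big)^T A_{\text{FD}} \big(I_h^{\text{FD}} D_h^{-\frac12}\big)$ is symmetric and positive definite. As a consequence, $A_h$ is invertible.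
   Context: The matrix $A_{\text{FD}}$ is defined as follows. Let $\psi(\xi)=\left(\sum_{l=1}^d 4\sin^2(\xi_l/2)\right)^s$ for $\xi\in\mathbb{R}^d$, and for $p\in\mathbb{Z}^d$ let $$T_p=\frac{1}{(2\pi)^d}\int_{(-\pi,\pi)^d}\psi(\xi)\,e^{i\,p\cdot\xi}\,d\xi .$$ The rows and columns of $A_{\text{FD}}$ are indexed by $\{-N,\dots,N\}^d$ (in some fixed ordering), with entries $(A_{\text{FD}})_{j,m}=T_{j-m}$ for $j,m\in\{-N,\dots,N\}^d$. *)

theory Defs
  imports "HOL-Analysis.Analysis" "Jordan_Normal_Form.Gauss_Jordan_Elimination"
    "Jordan_Normal_Form.DL_Rank"
begin

no_notation Matrix.vec_index (infixl \<open>$\<close> 100)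

definition fd_symbol :: "real \<Rightarrow> real ^ 'd \<Rightarrow> real" where
  "fd_symbol s \<xi> = (\<Sum>l\<in>UNIV. 4 * (sin (\<xi> $ l / 2))\<^sup>2) powr s"

definition fd_coeff :: "real \<Rightarrow> int ^ 'd \<Rightarrow> complex" where
  "fd_coeff s p = 1 / (2 * of_real pi) ^ CARD('d) *
     (LINT \<xi>:box (\<chi> l. - pi) (\<chi> l. pi)|lborel.
        of_real (fd_symbol s \<xi>) *
        exp (\<i> * of_real (\<Sum>l\<in>UNIV. of_int (p $ l) * \<xi> $ l)))"

definition fd_grid :: "nat \<Rightarrow> (int ^ 'd) set" where
  "fd_grid N = {p. \<forall>l. p $ l \<in> {- int N..int N}}"

text \<open>The ordering of the grid is a bijection \<open>e\<close> from \<open>{..<(2 * N + 1) ^ CARD('d)}\<close> onto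
  \<open>fd_grid N\<close>. The coefficients are real (lemma \<open>of_real_A_FD\<close> below), so passing to the real
  part only changes the type.\<close>

definition A_FD :: "real \<Rightarrow> nat \<Rightarrow> (nat \<Rightarrow> int ^ 'd) \<Rightarrow> real mat" where
  "A_FD s N e = Matrix.mat ((2 * N + 1) ^ CARD('d)) ((2 * N + 1) ^ CARD('d))
     (\<lambda>(i, k). Re (fd_coeff s (e i - e k)))"

lemma fd_coeff_real:
  fixes p :: "int ^ 'd"
  shows "complex_of_real (Re (fd_coeff s p)) = fd_coeff s p"
proof -
  define B :: "(real ^ 'd) set" where "B = box (\<chi> l. - pi) (\<chi> l. pi)"
  define E where "E = (\<lambda>\<xi> :: real ^ 'd. indicat_real B \<xi> *\<^sub>R (complex_of_real (fd_symbol s \<xi>) *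
        exp (\<i> * of_real (\<Sum>l\<in>UNIV. of_int (p $ l) * \<xi> $ l))))"
  have minus_B: "- \<xi> \<in> B \<longleftrightarrow> \<xi> \<in> B" for \<xi>
    unfolding B_def by (auto simp: mem_box_cart) (metis minus_less_iff minus_minus)+
  have cnj_E: "cnj (E \<xi>) = E (- \<xi>)" for \<xi>
    by (simp add: E_def indicator_def minus_B fd_symbol_def exp_cnj sum_negf)
  have "cnj (integral\<^sup>L lborel E) = (\<integral>\<xi>. E (- \<xi>) \<partial>lborel)"
    by (simp flip: cnj_E)
  also have "\<dots> = integral\<^sup>L (distr lborel borel uminus) E"
  proof (rule integral_distr[symmetric])
    show "E \<in> borel_measurable borel"
      unfolding E_def fd_symbol_def B_def by measurable
  qed auto
  also have "\<dots> = integral\<^sup>L lborel E"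
    using lborel_affine[of "-1" "0 :: real ^ 'd"] by (simp add: density_1)
  finally have "cnj (fd_coeff s p) = fd_coeff s p"
    unfolding fd_coeff_def set_lebesgue_integral_def E_def B_def by simp
  then show ?thesis
    by (metis Reals_cnj_iff of_real_Re)
qed

lemma of_real_A_FD:
  fixes e :: "nat \<Rightarrow> int ^ 'd"
  assumes "i < (2 * N + 1) ^ CARD('d)" "k < (2 * N + 1) ^ CARD('d)"
  shows "complex_of_real (A_FD s N e $$ (i, k)) = fd_coeff s (e i - e k)"
  using assms by (simp add: A_FD_def fd_coeff_real)

definition col_sum :: "real mat \<Rightarrow> nat \<Rightarrow> real" where
  "col_sum M j = (\<Sum>i<dim_row M. M $$ (i, j))"

definition D_h :: "real mat \<Rightarrow> real mat" where
  "D_h M = mat_diag (dim_col M) (col_sum M)"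

text \<open>The real power of a diagonal matrix with positive diagonal entries.\<close>

definition diag_powr :: "real mat \<Rightarrow> real \<Rightarrow> real mat" where
  "diag_powr D a = mat_diag (dim_row D) (\<lambda>i. D $$ (i, i) powr a)"

text \<open>\<open>mat_inverse D = None\<close> if \<open>D\<close> is singular; positive column sums exclude this.\<close>

definition A_h :: "real \<Rightarrow> nat \<Rightarrow> (nat \<Rightarrow> int ^ 'd) \<Rightarrow> real mat \<Rightarrow> real mat" where
  "A_h s N e M = the (mat_inverse (D_h M)) * transpose_mat M * A_FD s N e * M"

definition sym_mat :: "'a mat \<Rightarrow> bool" where
  "sym_mat A \<longleftrightarrow> transpose_mat A = A"

definition pos_def_mat :: "real mat \<Rightarrow> bool" where
  "pos_def_mat A \<longleftrightarrow> square_mat A \<and>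
     (\<forall>v \<in> carrier_vec (dim_row A). v \<noteq> 0\<^sub>v (dim_row A) \<longrightarrow> 0 < scalar_prod v (A *\<^sub>v v))"

end

theory Submission
  imports Defs
begin

text \<open>
  The whole statement rests on the positive definiteness of the grid matrix \<open>A_FD\<close>. Its entries
  are Fourier coefficients of the symbol \<open>\<psi> = fd_symbol s\<close>, so expanding
  \<open>|\<Sum>\<^sub>i v\<^sub>i exp (\<i> e\<^sub>i \<cdot> \<xi>)|\<^sup>2\<close> under the integral gives (\<open>fd_quadratic_form\<close>)

    \<open>(2\<pi>)\<^sup>d (v\<^sup>T A_FD v) = \<integral> \<psi>(\<xi>) |\<Sum>\<^sub>i v\<^sub>i exp (\<i> e\<^sub>i \<cdot> \<xi>)|\<^sup>2 d\<xi>\<close>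

  over the cube \<open>[-\<pi>, \<pi>]\<^sup>d\<close>. The integrand is continuous and nonnegative, so if the integral
  vanished, then so would the integrand at every point of the cube. This is contradicted without
  any orthogonality relation in several variables: on the line \<open>\<xi> = t w\<close> with positive integer
  weights \<open>w\<close> that separate the finitely many frequencies \<open>e\<^sub>i\<close> (\<open>separating_weights\<close>), the symbol
  is positive for small \<open>t > 0\<close>, and the trigonometric polynomial has one variable and distinct
  integer frequencies, hence its coefficients vanish (\<open>exponentials_independent\<close>). This is
  \<open>fd_quadratic_form_pos\<close>.

  The rest is linear algebra. Positive definiteness and symmetry pass to \<open>R\<^sup>T A_FD R\<close> when \<open>R\<close> is
  injective, and \<open>R = I D\<^sup>-\<^sup>1\<^sup>/\<^sup>2\<close> is injective because a matrix of full column rank is. Splitting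
  \<open>D\<^sup>-\<^sup>1 = D\<^sup>-\<^sup>1\<^sup>/\<^sup>2 D\<^sup>-\<^sup>1\<^sup>/\<^sup>2\<close> exhibits \<open>A_h\<close> as the conjugate of \<open>R\<^sup>T A_FD R\<close> by \<open>D\<^sup>-\<^sup>1\<^sup>/\<^sup>2\<close>, so the two
  have the same nonzero determinant.
\<close>

section \<open>Independence of exponentials\<close>

text \<open>After multiplication by \<open>cis (K t)\<close>, with \<open>K\<close> so large that all frequencies become
  nonnegative, the sum is a polynomial in \<open>cis t\<close>. It vanishes on an arc of the unit circle, so
  it has infinitely many roots.\<close>

lemma exponentials_independent:
  fixes k :: "'i \<Rightarrow> int" and c :: "'i \<Rightarrow> complex"
  assumes "finite I" "inj_on k I" "0 < \<delta>"
    and zero: "\<And>t. 0 < t \<Longrightarrow> t < \<delta> \<Longrightarrow> (\<Sum>i\<in>I. c i * cis (of_int (k i) * t)) = 0"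
    and "i \<in> I"
  shows "c i = 0"
proof -
  define K where "K = (\<Sum>i\<in>I. \<bar>k i\<bar>)"
  define m where "m = (\<lambda>i. nat (k i + K))"
  have K: "\<bar>k i\<bar> \<le> K" if "i \<in> I" for i
    using that assms(1) unfolding K_def by (metis abs_ge_zero member_le_sum)
  have m: "int (m i) = k i + K" if "i \<in> I" for i
    using K[OF that] by (simp add: m_def)
  have inj_m: "inj_on m I"
    using assms(2) m by (metis add_right_cancel inj_on_def)
  define p where "p = (\<Sum>i\<in>I. Polynomial.monom (c i) (m i))"
  have root: "poly p (cis t) = 0" if t: "0 < t" "t < \<delta>" for t
  proof -
    have "cis t ^ m i = cis (of_int K * t) * cis (of_int (k i) * t)" if "i \<in> I" for i
    proof -
      have "real (m i) = of_int (k i) + of_int K"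
        using m[OF that] by (metis of_int_add of_int_of_nat_eq)
      then show ?thesis
        by (simp add: Complex.DeMoivre cis_mult algebra_simps)
    qed
    then have "poly p (cis t) = (\<Sum>i\<in>I. c i * (cis (of_int K * t) * cis (of_int (k i) * t)))"
      by (simp add: p_def poly_sum poly_monom)
    also have "\<dots> = cis (of_int K * t) * (\<Sum>i\<in>I. c i * cis (of_int (k i) * t))"
      by (simp add: sum_distrib_left mult_ac)
    finally show ?thesis
      using zero[OF t] by simp
  qed
  have "inj_on cis {0<..<min \<delta> pi}"
  proof (rule inj_onI)
    fix x y
    assume xy: "x \<in> {0<..<min \<delta> pi}" "y \<in> {0<..<min \<delta> pi}" and "cis x = cis y"
    then have "cos x = cos y"
      by (metis cis.sel(1))
    with xy show "x = y"
      using cos_inj_pi[of x y] by simp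
  qed
  then have "infinite (cis ` {0<..<min \<delta> pi})"
    using assms(3) by (simp add: finite_image_iff)
  moreover have "cis ` {0<..<min \<delta> pi} \<subseteq> {z. poly p z = 0}"
    using root by auto
  ultimately have "p = 0"
    using poly_roots_finite finite_subset by blast
  then have "0 = poly.coeff p (m i)"
    by simp
  also have "\<dots> = (\<Sum>j\<in>I. if j = i then c j else 0)"
    unfolding p_def coeff_sum using inj_m assms(5)
    by (intro sum.cong) (auto simp: inj_on_def)
  also have "\<dots> = c i"
    using assms(1,5) by simp
  finally show ?thesis
    by simp
qed

text \<open>The weights are distinct powers of a base \<open>b\<close> exceeding every difference of coordinates.
  Two vectors with the same weighted sum then agree: at the lowest power where they differ, \<open>b\<close>
  would divide a nonzero difference smaller than \<open>b\<close>. Positivity of the weights makes the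
  line \<open>t w\<close> avoid the zero of the symbol at the origin.\<close>

lemma separating_weights:
  fixes F :: "(int ^ 'd) set"
  assumes "finite F"
  obtains w :: "'d \<Rightarrow> int" where "\<And>l. 0 < w l" "inj_on (\<lambda>p. \<Sum>l\<in>UNIV. p $ l * w l) F"
proof -
  define b where "b = 2 * (\<Sum>p\<in>F. \<Sum>l\<in>UNIV. \<bar>p $ l\<bar>) + 1"
  have le: "2 * \<bar>p $ l\<bar> < b" if "p \<in> F" for p l
  proof -
    have "\<bar>p $ l\<bar> \<le> (\<Sum>l\<in>UNIV. \<bar>p $ l\<bar>)"
      by (rule member_le_sum) auto
    also have "\<dots> \<le> (\<Sum>p\<in>F. \<Sum>l\<in>UNIV. \<bar>p $ l\<bar>)"
      using assms that by (intro member_le_sum) (auto intro: sum_nonneg)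
    finally show ?thesis
      by (simp add: b_def)
  qed
  have "0 < b"
    by (simp add: b_def add_nonneg_pos sum_nonneg)
  obtain ix :: "'d \<Rightarrow> nat" where ix: "inj ix"
    using finite_imp_inj_to_nat_seg[of "UNIV :: 'd set"] by auto
  have "p = q" if pq: "p \<in> F" "q \<in> F"
    and eq: "(\<Sum>l\<in>UNIV. p $ l * b ^ ix l) = (\<Sum>l\<in>UNIV. q $ l * b ^ ix l)" for p q
  proof (rule ccontr)
    assume "p \<noteq> q"
    define r where "r = (\<lambda>l. p $ l - q $ l)"
    have r: "\<bar>r l\<bar> < b" for l
      using le[OF pq(1), of l] le[OF pq(2), of l] by (simp add: r_def)
    have "\<exists>l. r l \<noteq> 0"
      using \<open>p \<noteq> q\<close> by (auto simp: r_def Finite_Cartesian_Product.vec_eq_iff)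
    then obtain l where l: "r l \<noteq> 0" and min: "\<And>l'. r l' \<noteq> 0 \<Longrightarrow> ix l \<le> ix l'"
      using ex_has_least_nat[of "\<lambda>l. r l \<noteq> 0" _ ix] by blast
    have "b ^ Suc (ix l) dvd r l' * b ^ ix l'" if "l' \<noteq> l" for l'
    proof (cases "r l' = 0")
      case False
      then have "Suc (ix l) \<le> ix l'"
        using min[of l'] ix that by (metis Suc_leI inj_eq le_neq_implies_less)
      then show ?thesis
        by (intro dvd_mult le_imp_power_dvd)
    qed auto
    then have "b ^ Suc (ix l) dvd (\<Sum>l'\<in>UNIV - {l}. r l' * b ^ ix l')"
      by (intro dvd_sum) auto
    moreover have "0 = r l * b ^ ix l + (\<Sum>l'\<in>UNIV - {l}. r l' * b ^ ix l')"
      using eq sum.remove[of UNIV l "\<lambda>l'. r l' * b ^ ix l'"]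
      by (simp add: r_def left_diff_distrib sum_subtractf)
    ultimately have "b ^ Suc (ix l) dvd r l * b ^ ix l"
      by (metis dvd_0_right dvd_add_left_iff)
    then have "b dvd r l"
      using \<open>0 < b\<close> by simp
    then show False
      using l r[of l] by (meson dvd_imp_le_int not_le zdvd_not_zless abs_of_pos dvd_abs_iff zero_less_abs_iff)
  qed
  then have "inj_on (\<lambda>p. \<Sum>l\<in>UNIV. p $ l * b ^ ix l) F"
    by (auto intro!: inj_onI)
  with \<open>0 < b\<close> show thesis
    by (intro that[of "\<lambda>l. b ^ ix l"]) auto
qed

section \<open>The quadratic form of the symbol\<close>

definition phase :: "int ^ 'd \<Rightarrow> real ^ 'd \<Rightarrow> real" where
  "phase p \<xi> = (\<Sum>l\<in>UNIV. of_int (p $ l) * \<xi> $ l)"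

lemma phase_diff: "phase (p - q) \<xi> = phase p \<xi> - phase q \<xi>"
  by (simp add: phase_def left_diff_distrib sum_subtractf)

lemma continuous_on_phase [continuous_intros]: "continuous_on S (phase p)"
  unfolding phase_def[abs_def] by (intro continuous_intros)

lemma fd_symbol_nonneg: "0 \<le> fd_symbol s \<xi>"
  by (simp add: fd_symbol_def)

lemma continuous_on_fd_symbol:
  assumes "0 < s"
  shows "continuous_on S (fd_symbol s)"
  unfolding fd_symbol_def[abs_def] using assms
  by (intro continuous_on_powr' continuous_intros) (auto intro: sum_nonneg)

text \<open>The cube may be taken closed because its boundary is a null set; continuity on a compact set
  then provides all integrability.\<close>

lemma Re_fd_coeff:
  fixes p :: "int ^ 'd"
  assumes "0 < s"
  shows "Re (fd_coeff s p) = integral (cbox (\<chi> l. - pi) (\<chi> l. pi)) (\<lambda>\<xi>. fd_symbol s \<xi> * cos (phase p \<xi>))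
    / (2 * pi) ^ CARD('d)"
proof -
  let ?a = "(\<chi> l. - pi) :: real ^ 'd" and ?b = "(\<chi> l. pi) :: real ^ 'd"
  define F where "F = (\<lambda>\<xi> :: real ^ 'd. complex_of_real (fd_symbol s \<xi>) * exp (\<i> * of_real (phase p \<xi>)))"
  have cont: "continuous_on S F" for S
    unfolding F_def
    by (intro continuous_intros continuous_on_fd_symbol assms)
  have "set_integrable lborel (cbox ?a ?b) F"
    unfolding set_integrable_def by (intro borel_integrable_compact cont compact_cbox)
  then have "set_integrable lborel (box ?a ?b) F"
    by (rule set_integrable_subset) (auto simp: box_subset_cbox)
  then have "(LINT \<xi>:box ?a ?b|lborel. F \<xi>) = integral (cbox ?a ?b) F"
    by (simp add: set_borel_integral_eq_integral integral_open_interval)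
  then have "fd_coeff s p = integral (cbox ?a ?b) F / of_real ((2 * pi) ^ CARD('d))"
    by (simp add: fd_coeff_def F_def phase_def)
  moreover have "Re (integral (cbox ?a ?b) F) = integral (cbox ?a ?b) (Re \<circ> F)"
    by (rule integral_linear[symmetric]) (auto intro: integrable_continuous cont bounded_linear_Re)
  moreover have "Re \<circ> F = (\<lambda>\<xi>. fd_symbol s \<xi> * cos (phase p \<xi>))"
    by (auto simp: F_def Re_exp)
  ultimately show ?thesis
    by (simp add: Re_divide_of_real)
qed

text \<open>This is \<open>|\<Sum>\<^sub>i v\<^sub>i exp (\<i> e\<^sub>i \<cdot> \<xi>)|\<^sup>2\<close> for real \<open>v\<close>, split into real and imaginary part.\<close>

definition trig_poly_sq :: "'i set \<Rightarrow> ('i \<Rightarrow> int ^ 'd) \<Rightarrow> ('i \<Rightarrow> real) \<Rightarrow> real ^ 'd \<Rightarrow> real" where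
  "trig_poly_sq I e v \<xi> =
    (\<Sum>i\<in>I. v i * cos (phase (e i) \<xi>))\<^sup>2 + (\<Sum>i\<in>I. v i * sin (phase (e i) \<xi>))\<^sup>2"

lemma continuous_on_trig_poly_sq [continuous_intros]: "continuous_on S (trig_poly_sq I e v)"
  unfolding trig_poly_sq_def[abs_def] by (intro continuous_intros)

lemma trig_poly_sq_expand:
  "trig_poly_sq I e v \<xi> = (\<Sum>i\<in>I. \<Sum>k\<in>I. v i * v k * cos (phase (e i - e k) \<xi>))"
  by (simp add: trig_poly_sq_def power2_eq_square sum_product phase_diff cos_diff algebra_simps
      sum.distrib)

lemma fd_quadratic_form:
  fixes e :: "'i \<Rightarrow> int ^ 'd"
  assumes "0 < s" "finite I"
  shows "(\<Sum>i\<in>I. \<Sum>k\<in>I. v i * v k * Re (fd_coeff s (e i - e k))) =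
    integral (cbox (\<chi> l. - pi) (\<chi> l. pi)) (\<lambda>\<xi>. fd_symbol s \<xi> * trig_poly_sq I e v \<xi>)
      / (2 * pi) ^ CARD('d)"
proof -
  let ?Q = "cbox (\<chi> l. - pi) (\<chi> l. pi) :: (real ^ 'd) set"
  have int: "(\<lambda>\<xi>. c * (fd_symbol s \<xi> * cos (phase p \<xi>))) integrable_on ?Q" for c and p :: "int ^ 'd"
    by (intro integrable_continuous continuous_intros continuous_on_fd_symbol assms)
  have "integral ?Q (\<lambda>\<xi>. fd_symbol s \<xi> * trig_poly_sq I e v \<xi>) =
    integral ?Q (\<lambda>\<xi>. \<Sum>i\<in>I. \<Sum>k\<in>I. v i * v k * (fd_symbol s \<xi> * cos (phase (e i - e k) \<xi>)))"
    by (simp add: trig_poly_sq_expand sum_distrib_left mult_ac)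
  also have "\<dots> = (\<Sum>i\<in>I. \<Sum>k\<in>I. v i * v k *
      integral ?Q (\<lambda>\<xi>. fd_symbol s \<xi> * cos (phase (e i - e k) \<xi>)))"
    using assms(2) by (simp add: integral_sum int integrable_sum)
  finally show ?thesis
    by (simp add: Re_fd_coeff[OF assms(1)] sum_divide_distrib)
qed

text \<open>A zero integral forces the integrand \<open>G\<close> to vanish on the whole cube, in particular along
  the line spanned by separating weights, where \<open>G\<close> controls a one-variable exponential sum.\<close>

lemma fd_quadratic_form_pos:
  fixes e :: "'i \<Rightarrow> int ^ 'd"
  assumes "0 < s" "finite I" "inj_on e I" "i \<in> I" "v i \<noteq> 0"
  shows "0 < (\<Sum>i\<in>I. \<Sum>k\<in>I. v i * v k * Re (fd_coeff s (e i - e k)))"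
proof -
  let ?Q = "cbox (\<chi> l. - pi) (\<chi> l. pi) :: (real ^ 'd) set"
  define G where "G = (\<lambda>\<xi>. fd_symbol s \<xi> * trig_poly_sq I e v \<xi>)"
  have cont: "continuous_on ?Q G"
    unfolding G_def by (intro continuous_intros continuous_on_fd_symbol assms(1))
  have nonneg: "0 \<le> G \<xi>" for \<xi>
    by (simp add: G_def fd_symbol_nonneg trig_poly_sq_def)
  have "integral ?Q G \<noteq> 0"
  proof
    assume "integral ?Q G = 0"
    then have "(G has_integral 0) ?Q"
      using integrable_integral[OF integrable_continuous[OF cont]] by simp
    then have G_zero: "G \<xi> = 0" if "\<xi> \<in> ?Q" for \<xi>
    proof (intro has_integral_0_cbox_imp_0[OF cont nonneg _ _ that])
      have "0 \<in> box (\<chi> l. - pi) ((\<chi> l. pi) :: real ^ 'd)"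
        by (simp add: mem_box_cart)
      then show "box (\<chi> l. - pi) ((\<chi> l. pi) :: real ^ 'd) \<noteq> {}"
        by blast
    qed
    obtain w where w: "\<And>l. 0 < w l" and inj_w: "inj_on (\<lambda>p. \<Sum>l\<in>UNIV. p $ l * w l) (e ` I)"
      using separating_weights[of "e ` I"] assms(2) by blast
    define k where "k = (\<lambda>i. \<Sum>l\<in>UNIV. e i $ l * w l)"
    (* For 0 < t < \<delta> the point t * w lies in the cube (0, pi)^d, where all the
       half-angle sines in the symbol are positive. *)
    define \<delta> where "\<delta> = pi / of_int (\<Sum>l\<in>UNIV. w l)"
    have w_le: "w l \<le> (\<Sum>l\<in>UNIV. w l)" for l
      using w by (intro member_le_sum) (auto intro: less_imp_le)
    then have W: "0 < (\<Sum>l\<in>UNIV. w l)"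
      using w by (meson less_le_trans)
    have inj_k: "inj_on k I"
      using comp_inj_on[OF assms(3) inj_w] by (simp add: k_def comp_def)
    have "(\<Sum>i\<in>I. complex_of_real (v i) * cis (of_int (k i) * t)) = 0" if t: "0 < t" "t < \<delta>" for t
    proof -
      define \<xi> :: "real ^ 'd" where "\<xi> = (\<chi> l. t * of_int (w l))"
      have pos: "0 < \<xi> $ l" for l
        using w t by (simp add: \<xi>_def)
      have less: "\<xi> $ l < pi" for l
      proof -
        have "\<xi> $ l \<le> t * of_int (\<Sum>l\<in>UNIV. w l)"
          using t w_le[of l] unfolding \<xi>_def by (simp del: of_int_sum)
        also have "\<dots> < pi"
          using t W unfolding \<delta>_def by (simp add: pos_less_divide_eq del: of_int_sum)
        finally show ?thesis .
      qed
      have "0 < sin (\<xi> $ l / 2)" for l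
        using pos[of l] less[of l] by (intro sin_gt_zero) auto
      then have "0 < (\<Sum>l\<in>UNIV. 4 * (sin (\<xi> $ l / 2))\<^sup>2)"
        by (intro sum_pos) (auto simp: less_imp_neq[symmetric])
      then have "0 < fd_symbol s \<xi>"
        by (simp add: fd_symbol_def)
      moreover have "G \<xi> = 0"
        using pos less by (intro G_zero) (auto simp: mem_box_cart less_imp_le intro: order_trans[of _ 0])
      ultimately have "trig_poly_sq I e v \<xi> = 0"
        by (simp add: G_def)
      moreover have "phase (e i) \<xi> = of_int (k i) * t" for i
        by (simp add: phase_def \<xi>_def k_def sum_distrib_left mult_ac)
      ultimately show ?thesis
        by (simp add: trig_poly_sq_def complex_eq_iff add_nonneg_eq_0_iff)
    qed
    moreover have "0 < \<delta>"
      using W by (simp add: \<delta>_def del: of_int_sum)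
    ultimately have "complex_of_real (v i) = 0"
      by (intro exponentials_independent[OF assms(2) inj_k _ _ assms(4),
            of \<delta> "\<lambda>i. complex_of_real (v i)"])
    then show False
      using assms(5) by simp
  qed
  moreover have "0 \<le> integral ?Q G"
    using nonneg by (intro integral_nonneg integrable_continuous cont) auto
  ultimately show ?thesis
    unfolding fd_quadratic_form[OF assms(1,2)] G_def by simp
qed

section \<open>Congruence and invertibility\<close>

text \<open>A basis of the column space chosen among the columns has \<open>m\<close> elements, which leaves no
  room for repeated columns. Hence the set of columns carries all of them, and its linear
  independence is injectivity of \<open>M\<close>.\<close>

lemma inj_of_full_column_rank:
  fixes M :: "'a :: field mat"
  assumes M: "M \<in> carrier_mat n m" and rank: "vec_space.rank n M = m"
    and v: "v \<in> carrier_vec m" "M *\<^sub>v v = 0\<^sub>v n"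
  shows "v = 0\<^sub>v m"
proof -
  interpret vec_space "TYPE('a)" n .
  obtain S where S: "maximal S (\<lambda>T. T \<subseteq> set (cols M) \<and> lin_indpt T)"
    using maximal_exists[of "\<lambda>T. T \<subseteq> set (cols M) \<and> lin_indpt T" "card (set (cols M))" "{}"]
    by (meson List.finite_set card_mono empty_iff empty_subsetI finite_lin_indpt2 rev_finite_subset)
  then have "card S = m" "S \<subseteq> set (cols M)"
    using rank_card_indpt[OF M] rank by (auto simp: maximal_def)
  then have "m \<le> card (set (cols M))"
    by (metis List.finite_set card_mono)
  then have "distinct (cols M)"
    using M card_length[of "cols M"] by (intro card_distinct) auto
  then show ?thesis
    using full_rank_lin_indpt[OF M rank] lin_depI[OF M v(1) _ v(2)] by blast
qed

text \<open>\<open>v\<^sup>T (R\<^sup>T A R) v = (R v)\<^sup>T A (R v)\<close>, and \<open>R v\<close> is nonzero for nonzero \<open>v\<close>.\<close>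

lemma pos_def_mat_congruence:
  assumes "A \<in> carrier_mat n n" "pos_def_mat A" "R \<in> carrier_mat n m"
    and inj: "\<And>v :: real Matrix.vec. v \<in> carrier_vec m \<Longrightarrow> R *\<^sub>v v = 0\<^sub>v n \<Longrightarrow> v = 0\<^sub>v m"
  shows "pos_def_mat (transpose_mat R * A * R)"
  unfolding pos_def_mat_def
proof (intro conjI ballI impI)
  have RT: "transpose_mat R \<in> carrier_mat m n"
    using assms(3) by simp
  fix v :: "real Matrix.vec"
  assume v: "v \<in> carrier_vec (dim_row (transpose_mat R * A * R))"
    "v \<noteq> 0\<^sub>v (dim_row (transpose_mat R * A * R))"
  with assms(3) have v: "v \<in> carrier_vec m" "v \<noteq> 0\<^sub>v m"
    by auto
  then have Rv: "R *\<^sub>v v \<in> carrier_vec n" "R *\<^sub>v v \<noteq> 0\<^sub>v n"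
    using assms(3) inj by auto
  have "(transpose_mat R * A * R) *\<^sub>v v = transpose_mat R *\<^sub>v (A *\<^sub>v (R *\<^sub>v v))"
    using assoc_mult_mat_vec[OF mult_carrier_mat[OF RT assms(1)] assms(3) v(1)]
      assoc_mult_mat_vec[OF RT assms(1) Rv(1)] by simp
  then have "scalar_prod v ((transpose_mat R * A * R) *\<^sub>v v) =
      scalar_prod (transpose_mat R *\<^sub>v (A *\<^sub>v (R *\<^sub>v v))) v"
    using v assms(1,3) by (simp add: comm_scalar_prod[of v m])
  also have "\<dots> = scalar_prod (A *\<^sub>v (R *\<^sub>v v)) (R *\<^sub>v v)"
    using v Rv assms(1,3) by (intro transpose_vec_mult_scalar) auto
  also have "\<dots> = scalar_prod (R *\<^sub>v v) (A *\<^sub>v (R *\<^sub>v v))"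
    using Rv assms(1) by (intro comm_scalar_prod[of _ n]) auto
  also have "\<dots> > 0"
    using assms(1,2) Rv by (auto simp: pos_def_mat_def)
  finally show "0 < scalar_prod v ((transpose_mat R * A * R) *\<^sub>v v)" .
qed (use assms in auto)

lemma sym_mat_congruence:
  fixes A :: "'a :: comm_semiring_0 mat"
  assumes "A \<in> carrier_mat n n" "sym_mat A" "R \<in> carrier_mat n m"
  shows "sym_mat (transpose_mat R * A * R)"
proof -
  have RT: "transpose_mat R \<in> carrier_mat m n"
    using assms(3) by simp
  have "transpose_mat (transpose_mat R * A * R) = transpose_mat R * transpose_mat (transpose_mat R * A)"
    by (rule transpose_mult[OF mult_carrier_mat[OF RT assms(1)] assms(3)])
  also have "\<dots> = transpose_mat R * (A * R)"
    using assms(2) by (simp add: transpose_mult[OF RT assms(1)] sym_mat_def)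
  also have "\<dots> = transpose_mat R * A * R"
    by (rule assoc_mult_mat[OF RT assms(1,3), symmetric])
  finally show ?thesis
    by (simp add: sym_mat_def)
qed

lemma pos_def_mat_det_nonzero:
  assumes "A \<in> carrier_mat n n" "pos_def_mat A"
  shows "Determinant.det A \<noteq> 0"
proof
  assume "Determinant.det A = 0"
  then obtain v where "v \<in> carrier_vec n" "v \<noteq> 0\<^sub>v n" "A *\<^sub>v v = 0\<^sub>v n"
    using det_0_iff_vec_prod_zero[OF assms(1)] by blast
  then show False
    using assms by (auto simp: pos_def_mat_def)
qed

lemma det_nonzero_invertible_mat:
  fixes A :: "'a :: field mat"
  assumes "A \<in> carrier_mat n n" "Determinant.det A \<noteq> 0"
  shows "invertible_mat A"
proof -
  have "A \<in> Units (ring_mat TYPE('a) n ())"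
    by (rule det_non_zero_imp_unit[OF assms])
  then obtain B where "B \<in> carrier_mat n n" "B * A = 1\<^sub>m n" "A * B = 1\<^sub>m n"
    by (auto simp: Units_def ring_mat_def)
  then show ?thesis
    using assms(1) by (auto simp: invertible_mat_def inverts_mat_def)
qed

section \<open>The finite difference matrix\<close>

lemma A_FD_carrier:
  fixes e :: "nat \<Rightarrow> int ^ 'd"
  shows "A_FD s N e \<in> carrier_mat ((2 * N + 1) ^ CARD('d)) ((2 * N + 1) ^ CARD('d))"
  by (simp add: A_FD_def)

text \<open>The real part of the coefficient is a cosine integral, hence even in the frequency.\<close>

lemma sym_mat_A_FD:
  assumes "0 < s"
  shows "sym_mat (A_FD s N e)"
proof -
  have "Re (fd_coeff s (p - q)) = Re (fd_coeff s (q - p))" for p q :: "int ^ 'd"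
    by (simp add: Re_fd_coeff[OF assms] phase_diff cos_diff mult_ac)
  then show ?thesis
    unfolding sym_mat_def by (intro eq_matI) (auto simp: A_FD_def)
qed

lemma pos_def_mat_A_FD:
  fixes e :: "nat \<Rightarrow> int ^ 'd"
  assumes "0 < s" "inj_on e {..<(2 * N + 1) ^ CARD('d)}"
  shows "pos_def_mat (A_FD s N e)"
proof -
  define n where "n = (2 * N + 1) ^ CARD('d)"
  have A: "A_FD s N e \<in> carrier_mat n n"
    unfolding n_def by (rule A_FD_carrier)
  have entry: "A_FD s N e $$ (i, k) = Re (fd_coeff s (e i - e k))" if "i < n" "k < n" for i k
    using that by (simp add: A_FD_def n_def)
  have "0 < scalar_prod v (A_FD s N e *\<^sub>v v)" if v: "v \<in> carrier_vec n" "v \<noteq> 0\<^sub>v n" for v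
  proof -
    obtain i where i: "i < n" "vec_index v i \<noteq> 0"
      using v by (metis carrier_vecD eq_vecI index_zero_vec)
    have "vec_index (A_FD s N e *\<^sub>v v) i = (\<Sum>k<n. Re (fd_coeff s (e i - e k)) * vec_index v k)"
      if "i < n" for i
      using that v A by (simp add: scalar_prod_def entry atLeast0LessThan)
    then have "scalar_prod v (A_FD s N e *\<^sub>v v) =
      (\<Sum>i<n. \<Sum>k<n. vec_index v i * vec_index v k * Re (fd_coeff s (e i - e k)))"
      using A by (simp add: scalar_prod_def atLeast0LessThan sum_distrib_left mult_ac)
    then show ?thesis
      using fd_quadratic_form_pos[of s "{..<n}" e i "vec_index v"] i assms by (simp add: n_def)
  qed
  moreover have "dim_row (A_FD s N e) = n" "square_mat (A_FD s N e)"
    using A by simp_all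
  ultimately show ?thesis
    unfolding pos_def_mat_def by metis
qed

section \<open>Powers of the diagonal matrix\<close>

lemma diag_powr_D_h:
  "diag_powr (D_h M) a = mat_diag (dim_col M) (\<lambda>j. col_sum M j powr a)"
  unfolding diag_powr_def D_h_def by (auto simp: mat_diag_def)

lemma diag_powr_D_h_carrier [simp]: "diag_powr (D_h M) a \<in> carrier_mat (dim_col M) (dim_col M)"
  by (simp add: diag_powr_D_h)

lemma mat_diag_cong: "(\<And>i. i < n \<Longrightarrow> f i = g i) \<Longrightarrow> mat_diag n f = mat_diag n g"
  by (auto simp: mat_diag_def)

lemma diag_powr_mult:
  "diag_powr (D_h M) a * diag_powr (D_h M) b = diag_powr (D_h M) (a + b)"
  by (simp add: diag_powr_D_h powr_add)

lemma diag_powr_0: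
  assumes "\<forall>j < dim_col M. 0 < col_sum M j"
  shows "diag_powr (D_h M) 0 = 1\<^sub>m (dim_col M)"
proof -
  have "diag_powr (D_h M) 0 = mat_diag (dim_col M) (\<lambda>_. 1)"
    unfolding diag_powr_D_h using assms by (intro mat_diag_cong) (auto simp: less_imp_neq[symmetric])
  then show ?thesis
    by simp
qed

lemma diag_powr_1:
  assumes "\<forall>j < dim_col M. 0 < col_sum M j"
  shows "diag_powr (D_h M) 1 = D_h M"
proof -
  have "diag_powr (D_h M) 1 = mat_diag (dim_col M) (col_sum M)"
    unfolding diag_powr_D_h using assms by (intro mat_diag_cong) auto
  then show ?thesis
    by (simp add: D_h_def)
qed

text \<open>Inverses of matrices are unique, so whatever elimination computes agrees with the
  explicit candidate \<open>D\<^sup>-\<^sup>1\<close>.\<close>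

lemma mat_inverse_D_h:
  assumes "\<forall>j < dim_col M. 0 < col_sum M j"
  shows "mat_inverse (D_h M) = Some (diag_powr (D_h M) (- 1))"
proof -
  let ?m = "dim_col M" and ?E = "diag_powr (D_h M) (- 1)"
  have D: "D_h M \<in> carrier_mat ?m ?m"
    by (simp add: D_h_def)
  have E: "?E * D_h M = 1\<^sub>m ?m" "D_h M * ?E = 1\<^sub>m ?m"
    using diag_powr_mult[of M "- 1" 1] diag_powr_mult[of M 1 "- 1"]
    by (simp_all add: diag_powr_0[OF assms] diag_powr_1[OF assms])
  then have "D_h M \<in> Units (ring_mat TYPE(real) ?m ())"
    using D by (auto simp: Units_def ring_mat_def intro!: bexI[of _ ?E])
  then obtain B where B: "mat_inverse (D_h M) = Some B"
    using mat_inverse(1)[OF D, of "()"] by (cases "mat_inverse (D_h M)") auto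
  then have B': "D_h M * B = 1\<^sub>m ?m" "B \<in> carrier_mat ?m ?m"
    using mat_inverse(2)[OF D] by auto
  have "B = (?E * D_h M) * B"
    using B' E by simp
  also have "\<dots> = ?E * (D_h M * B)"
    by (rule assoc_mult_mat[OF diag_powr_D_h_carrier D B'(2)])
  also have "\<dots> = ?E"
    unfolding B' by (rule right_mult_one_mat[OF diag_powr_D_h_carrier])
  finally show ?thesis
    using B by simp
qed

section \<open>The transferred matrix\<close>

theorem theorem3p1:
  fixes s :: real and N N\<^sub>v :: nat
    and e :: "nat \<Rightarrow> int ^ 'd"
    and I_FD :: "real mat"
  assumes "0 < s" "s < 1" "0 < N" "0 < N\<^sub>v"
    and "bij_betw e {..<(2 * N + 1) ^ CARD('d)} (fd_grid N)"
    and "I_FD \<in> carrier_mat ((2 * N + 1) ^ CARD('d)) N\<^sub>v"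
    and "vec_space.rank ((2 * N + 1) ^ CARD('d)) I_FD = N\<^sub>v"
    and "\<forall>j<N\<^sub>v. 0 < col_sum I_FD j"
  shows "(\<exists>B. similar_mat (A_h s N e I_FD) B \<and> sym_mat B \<and> pos_def_mat B) \<and>
    (let R = I_FD * diag_powr (D_h I_FD) (- 1 / 2);
         B = transpose_mat R * A_FD s N e * R
     in A_h s N e I_FD = diag_powr (D_h I_FD) (- 1 / 2) * B * diag_powr (D_h I_FD) (1 / 2) \<and>
        sym_mat B \<and> pos_def_mat B) \<and>
    invertible_mat (A_h s N e I_FD)"
proof -
  define n where "n = (2 * N + 1) ^ CARD('d)"
  define A where "A = A_FD s N e"
  define P where "P = diag_powr (D_h I_FD) (- 1 / 2)"
  define Q where "Q = diag_powr (D_h I_FD) (1 / 2)"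
  define R where "R = I_FD * P"
  define B where "B = transpose_mat R * A * R"
  have M: "I_FD \<in> carrier_mat n N\<^sub>v" and A: "A \<in> carrier_mat n n"
    using assms(6) A_FD_carrier[of s N e] by (simp_all add: n_def A_def)
  then have dim: "dim_col I_FD = N\<^sub>v"
    by simp
  have pos: "\<forall>j < dim_col I_FD. 0 < col_sum I_FD j"
    using assms(8) dim by simp
  have P: "P \<in> carrier_mat N\<^sub>v N\<^sub>v" and Q: "Q \<in> carrier_mat N\<^sub>v N\<^sub>v"
    using diag_powr_D_h_carrier[of I_FD] dim by (simp_all add: P_def Q_def)
  have R: "R \<in> carrier_mat n N\<^sub>v"
    using M P by (simp add: R_def)
  have B: "B \<in> carrier_mat N\<^sub>v N\<^sub>v"
    using R A by (simp add: B_def)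
  have PQ: "P * Q = 1\<^sub>m N\<^sub>v" "Q * P = 1\<^sub>m N\<^sub>v"
    by (simp_all add: P_def Q_def diag_powr_mult diag_powr_0[OF pos] dim)
  have inv: "the (mat_inverse (D_h I_FD)) = P * P"
    by (simp add: mat_inverse_D_h[OF pos] P_def diag_powr_mult)
  have P_sym: "transpose_mat P = P"
    unfolding P_def diag_powr_D_h by (auto simp: mat_diag_def)
  have MT: "transpose_mat I_FD \<in> carrier_mat N\<^sub>v n"
    using M by simp
  note PMT = mult_carrier_mat[OF P MT]
  note PMTA = mult_carrier_mat[OF PMT A]
  note PMTAM = mult_carrier_mat[OF PMTA M]
  have "B = P * transpose_mat I_FD * A * (I_FD * P)"
    by (simp add: B_def R_def transpose_mult[OF M P] P_sym)
  also have "\<dots> = P * transpose_mat I_FD * A * I_FD * P"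
    by (rule assoc_mult_mat[OF PMTA M P, symmetric])
  (* B ends in the factor P, which cancels against Q. *)
  finally have "P * B * Q = P * (P * transpose_mat I_FD * A * I_FD) * (P * Q)"
    using assoc_mult_mat[OF P PMTAM P] assoc_mult_mat[OF mult_carrier_mat[OF P PMTAM] P Q] by simp
  also have "\<dots> = P * (P * transpose_mat I_FD * A * I_FD)"
    using right_mult_one_mat[OF mult_carrier_mat[OF P PMTAM]] PQ(1) by simp
  also have "\<dots> = P * P * transpose_mat I_FD * A * I_FD"
    using assoc_mult_mat[OF P PMTA M] assoc_mult_mat[OF P PMT A] assoc_mult_mat[OF P P MT] by simp
  also have "\<dots> = A_h s N e I_FD"
    by (simp add: A_h_def inv A_def)
  finally have A_h: "A_h s N e I_FD = P * B * Q"
    by simp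
  (* P is invertible with inverse Q, so R inherits injectivity from the transfer matrix. *)
  have inj: "v = 0\<^sub>v N\<^sub>v" if v: "v \<in> carrier_vec N\<^sub>v" "R *\<^sub>v v = 0\<^sub>v n" for v
  proof -
    have "I_FD *\<^sub>v (P *\<^sub>v v) = 0\<^sub>v n"
      using v M P by (simp add: R_def)
    then have "P *\<^sub>v v = 0\<^sub>v N\<^sub>v"
      using inj_of_full_column_rank[OF M] assms(7) P v by (simp add: n_def)
    then have "(Q * P) *\<^sub>v v = Q *\<^sub>v 0\<^sub>v N\<^sub>v"
      using P Q v by simp
    then show ?thesis
      using PQ Q v by auto
  qed
  have "pos_def_mat A" "sym_mat A"
    using assms(1,5) by (auto simp: A_def bij_betw_def intro: pos_def_mat_A_FD sym_mat_A_FD)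
  then have B_pos: "sym_mat B" "pos_def_mat B"
    using sym_mat_congruence[OF A _ R] pos_def_mat_congruence[OF A _ R] inj by (auto simp only: B_def)
  have carr: "A_h s N e I_FD \<in> carrier_mat N\<^sub>v N\<^sub>v"
    using P B Q by (simp add: A_h)
  have sim: "similar_mat (A_h s N e I_FD) B"
    using carr P B Q PQ A_h by (intro similar_matI[of _ _ P Q N\<^sub>v]) auto
  then have "Determinant.det (A_h s N e I_FD) \<noteq> 0"
    using det_similar pos_def_mat_det_nonzero[OF B B_pos(2)] by metis
  then have "invertible_mat (A_h s N e I_FD)"
    by (rule det_nonzero_invertible_mat[OF carr])
  then show ?thesis
    using sim B_pos A_h unfolding Let_def P_def Q_def R_def B_def A_def by blast
qed

end
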